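(* Let $n\ge 1$, let $\epsilon_1,\dots,\epsilon_{2n-1}$ be positive integers, and let $w=\sigma_1^{\epsilon_1}\sigma_2^{-\epsilon_2}\sigma_1^{\epsilon_3}\cdots\sigma_2^{-\epsilon_{2n-2}}\sigma_1^{\epsilon_{2n-1}}\in\mathbb{B}_3$. Let $T_w$ be the rational $2$-tangle with (alternating, standard) plat presentation $q_4(w)$, and suppose that its plat closure $K=\overline{q_4(w)}=p_4(w)$ is a $2$-bridge knot. Orient $K$ and give $T_w$ the induced orientation. For $1\le i\le 2n-1$ let $k_i\in\{1,2\}$ be the orientation type of the $i$-th block of $w$ (the block $\sigma_1^{\epsilon_i}$ if $i$ is odd, $\sigma_2^{-\epsilon_i}$ if $i$ is even). Put $$A^1_1=\begin{bmatrix}1&0&0\\0&0&-a^{-2}\\0&1&-a^{-1}m\end{bmatrix},\quad A^1_2=\begin{bmatrix}1&0&-am\\0&0&-a^{2}\\0&1&0\end{bmatrix},\quad B^{-1}_1=\begin{bmatrix}0&0&-a^{2}\\0&1&0\\1&0&-am\end{bmatrix},\quad B^{-1}_2=\begin{bmatrix}0&0&-a^{-2}\\0&1&-a^{-1}m\\1&0&0\end{bmatrix},$$ and $$M=(A^1_{k_1})^{\epsilon_1}(B^{-1}_{k_2})^{\epsilon_2}(A^1_{k_3})^{\epsilon_3}\cdots(B^{-1}_{k_{2n-2}})^{\epsilon_{2n-2}}(A^1_{k_{2n-1}})^{\epsilon_{2n-1}}.$$ Then the HOMFLY polynomial of the oriented tangle $T_w$ is $$P(T_w)=f(a,m)\,\langle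 T_0\rangle+g(a,m)\,\langle T_\infty\rangle+h(a,m)\,\langle T_x\rangle,$$ where $[f(a,m)\ \ g(a,m)\ \ h(a,m)]=[0\ \ 1\ \ 0]\,M^{t}$, i.e. $(f,g,h)$ is the second column of $M$. Moreover, $$P(K)=f(a,m)-g(a,m)\,\frac{a+a^{-1}}{m}+h(a,m).$$
   Context: HOMFLY polynomial. $P(L)=P_L(a,m)\in\mathbb{Z}[a^{\pm1},m^{\pm1}]$ is the isotopy invariant of oriented links in $S^3$ with $P(\text{unknot})=1$ and $a\,P(L_+)+a^{-1}P(L_-)+m\,P(L_0)=0$, where $L_+,L_-,L_0$ are diagrams identical except near one crossing, which is respectively a positive crossing, a negative crossing, and the orientation-respecting smoothing. Braids and plats. Consider $4$-string braids with string positions numbered $0,1,2,3$ from left to right; the string in position $0$ is always straight, so such a braid is an element of $\mathbb{B}_3$ on positions $1,2,3$. The generator $\sigma_1$ is a crossing of the strings in positions $1,2$ and $\sigma_2$ is a crossing of the strings in positions $2,3$; the handedness is such that $\sigma_1$ (and likewise $\sigma_2$), with both of its strands oriented downward or both upward, is a positive crossing $L_+$ (so $\sigma_i^{-1}$ with both strands parallel is a negative crossing). Words are read from top to bottom: the first letter of $w$ is the top of the braid. The tangle $q_4(w)$, lying in a lower half-space ball $B_2$ whose boundary meets the top of the braid, is the union of the braid $w$ and two unlinked, unknotted crossingless arcs at the bottom joining bottom positions $0,1$ and bottom positions $2,3$. It is a rational $2$-tangle, denoted $T_w$. The plat closure $p_4(w)=\overline{q_4(w)}$ is the link obtained from $q_4(w)$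 by adding, at the top, two crossingless unlinked arcs joining top positions $0,1$ and top positions $2,3$. A plat is called standard if the leftmost string of its braid is not involved in any crossing (this holds automatically for $q_4(w)$ and $p_4(w)$ with $w\in\mathbb{B}_3$ acting on positions $1,2,3$, since the string in position $0$ is straight). Basic tangles. $T_\infty=q_4(1)$ (trivial braid: crossingless arcs joining endpoints $0,1$ and $2,3$). $T_0$ is the crossingless tangle whose arcs join endpoints $1,2$ and $0,3$. $T_x=q_4(\sigma_1)$ (one crossing, arcs joining endpoints $0,2$ and $1,3$). Their symbols are $\langle T_0\rangle,\langle T_\infty\rangle,\langle T_x\rangle$. HOMFLY polynomial of an oriented tangle. For an oriented tangle $\overrightarrow{T_w}$, $P(T_w)=f\langle T_0\rangle+g\langle T_\infty\rangle+h\langle T_x\rangle$ denotes the expression obtained by starting with $\overrightarrow{T_w}$ and applying isotopy (rel boundary) and the skein relation $a\,L_++a^{-1}L_-+m\,L_0=0$ repeatedly until only the three tangles $T_0,T_\infty,T_x$ remain; that is, it is the expression of $\overrightarrow{T_w}$ in the HOMFLY skein module of oriented tangles in the ball $B_2$ with the same oriented endpoints (free module over $\mathbb{Z}[a^{\pm1},m^{\pm1}]$ on oriented tangles up to isotopy rel boundary, modulo the skein relation). For any given orientation of the endpoints exactly two of $T_0,T_\infty,T_x$ can be oriented compatibly with it; the coefficient of the remaining one is $0$. Orientation types. All crossings in one block $\sigma_1^{\epsilon_i}$ or $\sigma_2^{-\epsilon_i}$ involve the same two strands. The type $k_i$ is $1$ if the two strands twisted in the block are oriented in parallel (both upward or both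 downward), and $2$ if they are oriented oppositely (one upward, one downward). Reversing the orientation of the whole knot does not change the $k_i$. *)

theory Defs
  imports "HOL-Library.Poly_Mapping" "HOL-Library.Product_Plus" "Jordan_Normal_Form.Matrix"
begin

text \<open>
  The ring of integer Laurent polynomials in \<open>a\<close> and \<open>m\<close> is the group ring of \<open>int \<times> int\<close>:
  the key \<open>(i, j)\<close> stands for the monomial \<open>a\<^sup>i m\<^sup>j\<close>.
\<close>

type_synonym laurent = "(int \<times> int) \<Rightarrow>\<^sub>0 int"

definition apow :: "int \<Rightarrow> laurent" where
  "apow i = Poly_Mapping.single (i, 0) 1"

definition mpow :: "int \<Rightarrow> laurent" where
  "mpow j = Poly_Mapping.single (0, j) 1"

text \<open>
  Oriented tangle diagrams are in general position with respect to the height function and are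
  read from top to bottom as lists of elementary pieces. Strands are numbered from 0, left to
  right. \<open>Crossing i s\<close> crosses strands \<open>i\<close> and \<open>i + 1\<close>; for \<open>s = True\<close> the strand running from
  top right to bottom left is the upper one, so that the crossing is positive whenever its strands
  are parallel. \<open>Cap i d\<close> is a local maximum whose two legs become strands \<open>i\<close> and \<open>i + 1\<close>, and
  \<open>Cup i\<close> is a local minimum joining strands \<open>i\<close> and \<open>i + 1\<close>.

  The orientation at a given height is a list of booleans, \<open>True\<close> meaning downwards. It propagates
  from top to bottom; only a \<open>Cap\<close> needs a label, the direction \<open>d\<close> of its left leg. Hence the
  orientation at the top together with the labels is exactly an orientation of the diagram.
\<close>

datatype piece = Crossing nat bool | is_Cap: Cap nat bool | Cup nat

fun step :: "bool list \<Rightarrow> piece \<Rightarrow> bool list option" where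
  "step u (Crossing i s) =
     (if i + 1 < length u then Some (take i u @ [u ! (i + 1), u ! i] @ drop (i + 2) u) else None)"
| "step u (Cap i d) =
     (if i \<le> length u then Some (take i u @ [d, \<not> d] @ drop i u) else None)"
| "step u (Cup i) =
     (if i + 1 < length u \<and> u ! i \<noteq> u ! (i + 1) then Some (take i u @ drop (i + 2) u) else None)"

fun run :: "bool list \<Rightarrow> piece list \<Rightarrow> bool list option" where
  "run u [] = Some u"
| "run u (p # D) = Option.bind (step u p) (\<lambda>v. run v D)"

definition tangle :: "bool list \<Rightarrow> bool list \<Rightarrow> piece list \<Rightarrow> bool" where
  "tangle u v D \<longleftrightarrow> run u D = Some v"

abbreviation link :: "piece list \<Rightarrow> bool" where
  "link D \<equiv> tangle [] [] D"


subsection \<open>Isotopy\<close>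

fun pos :: "piece \<Rightarrow> nat" where
  "pos (Crossing i s) = i"
| "pos (Cap i d) = i"
| "pos (Cup i) = i"

fun reposition :: "nat \<Rightarrow> piece \<Rightarrow> piece" where
  "reposition j (Crossing i s) = Crossing j s"
| "reposition j (Cap i d) = Cap j d"
| "reposition j (Cup i) = Cup j"

fun ins :: "piece \<Rightarrow> nat" where
  "ins (Crossing i s) = 2"
| "ins (Cap i d) = 0"
| "ins (Cup i) = 2"

fun outs :: "piece \<Rightarrow> nat" where
  "outs (Crossing i s) = 2"
| "outs (Cap i d) = 2"
| "outs (Cup i) = 0"

text \<open>
  The Reidemeister moves \<open>R1\<close>, \<open>R2\<close>, \<open>R3\<close>, together with the planar moves relating diagrams in
  general position with respect to height: exchanging the heights of two distant pieces,
  cancelling a local maximum against a local minimum, and moving a crossing past an extremum.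
  By the Reidemeister theorem for such diagrams (Freyd--Yetter, Turaev), they generate isotopy of
  tangles relative to the boundary.
\<close>

inductive local_move :: "piece list \<Rightarrow> piece list \<Rightarrow> bool" where
  exchange: "pos p + outs p \<le> pos q \<Longrightarrow>
     local_move [p, q] [reposition (pos q - outs p + ins p) q, p]"
| zigzag_left: "local_move [Cap (i + 1) d, Cup i] []"
| zigzag_right: "local_move [Cap i d, Cup (i + 1)] []"
| slide_Cup: "local_move [Crossing i s, Cup (i + 1)] [Crossing (i + 1) (\<not> s), Cup i]"
| slide_Cap: "local_move [Cap (i + 1) d, Crossing i s] [Cap i d, Crossing (i + 1) (\<not> s)]"
| R1_Cup: "local_move [Crossing i s, Cup i] [Cup i]"
| R1_Cap: "local_move [Cap i d, Crossing i s] [Cap i (\<not> d)]"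
| R2: "local_move [Crossing i s, Crossing i (\<not> s)] []"
| R3: "local_move [Crossing i s, Crossing (i + 1) s, Crossing i s]
         [Crossing (i + 1) s, Crossing i s, Crossing (i + 1) s]"

definition isotopy_step :: "bool list \<Rightarrow> bool list \<Rightarrow> piece list \<Rightarrow> piece list \<Rightarrow> bool" where
  "isotopy_step u v D D' \<longleftrightarrow> tangle u v D \<and> tangle u v D' \<and>
     (\<exists>X l r Y. local_move l r \<and> D = X @ l @ Y \<and> D' = X @ r @ Y \<and> run u (X @ l) = run u (X @ r))"

definition isotopic :: "bool list \<Rightarrow> bool list \<Rightarrow> piece list \<Rightarrow> piece list \<Rightarrow> bool" where
  "isotopic u v D D' \<longleftrightarrow> tangle u v D \<and> equivclp (isotopy_step u v) D D'"


subsection \<open>Skein relation and HOMFLY polynomial\<close>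

text \<open>
  The diagrams \<open>L\<^sub>+\<close>, \<open>L\<^sub>-\<close>, \<open>L\<^sub>0\<close> differ only between \<open>X\<close> and \<open>Y\<close>; \<open>x\<close> is the orientation just above
  the crossing. Reversing one strand changes the sign of a crossing, so \<open>Crossing i True\<close> is positive
  iff its strands are parallel. The oriented smoothing of antiparallel strands is a minimum above
  a maximum.
\<close>

definition skein_triple ::
  "bool list \<Rightarrow> bool list \<Rightarrow> piece list \<Rightarrow> piece list \<Rightarrow> piece list \<Rightarrow> bool" where
  "skein_triple u v Lp Lm L0 \<longleftrightarrow> tangle u v Lp \<and>
     (\<exists>X Y x i parallel. run u X = Some x \<and> i + 1 < length x \<and>
        parallel = (x ! i = x ! (i + 1)) \<and>
        Lp = X @ [Crossing i parallel] @ Y \<and>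
        Lm = X @ [Crossing i (\<not> parallel)] @ Y \<and>
        L0 = X @ (if parallel then [] else [Cup i, Cap i (x ! (i + 1))]) @ Y)"

definition unknot :: "piece list" where
  "unknot = [Cap 0 True, Cup 0]"

definition is_HOMFLY :: "(piece list \<Rightarrow> laurent) \<Rightarrow> bool" where
  "is_HOMFLY P \<longleftrightarrow>
     (\<forall>D D'. isotopic [] [] D D' \<longrightarrow> P D = P D') \<and>
     P unknot = 1 \<and>
     (\<forall>Lp Lm L0. skein_triple [] [] Lp Lm L0 \<longrightarrow>
        apow 1 * P Lp + apow (-1) * P Lm + mpow 1 * P L0 = 0)"

text \<open>
  The skein module of tangles with boundary orientations \<open>u\<close>, \<open>v\<close> is the free module on the diagrams
  modulo the submodule generated by isotopies and skein relations; \<open>skein_eq\<close> is equality of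
  classes in this quotient.
\<close>

definition scale :: "laurent \<Rightarrow> (piece list \<Rightarrow>\<^sub>0 laurent) \<Rightarrow> (piece list \<Rightarrow>\<^sub>0 laurent)" where
  "scale c x = Poly_Mapping.map ((*) c) x"

lemma lookup_scale: "Poly_Mapping.lookup (scale c x) D = c * Poly_Mapping.lookup x D"
  by (simp add: scale_def Poly_Mapping.map.rep_eq when_def)

interpretation skein: Modules.module scale
  by unfold_locales
    (auto intro!: poly_mapping_eqI simp: lookup_scale lookup_add algebra_simps)

definition skein_relations :: "bool list \<Rightarrow> bool list \<Rightarrow> (piece list \<Rightarrow>\<^sub>0 laurent) set" where
  "skein_relations u v =
     {Poly_Mapping.single D 1 - Poly_Mapping.single D' 1 | D D'. isotopic u v D D'} \<union>
     {Poly_Mapping.single Lp (apow 1) + Poly_Mapping.single Lm (apow (-1))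
        + Poly_Mapping.single L0 (mpow 1) | Lp Lm L0. skein_triple u v Lp Lm L0}"

definition skein_eq ::
  "bool list \<Rightarrow> bool list \<Rightarrow> (piece list \<Rightarrow>\<^sub>0 laurent) \<Rightarrow> (piece list \<Rightarrow>\<^sub>0 laurent) \<Rightarrow> bool" where
  "skein_eq u v x y \<longleftrightarrow> x - y \<in> skein.span (skein_relations u v)"


subsection \<open>Plats\<close>

definition sigma :: "nat \<Rightarrow> piece" where
  "sigma i = Crossing i True"

definition sigma_inv :: "nat \<Rightarrow> piece" where
  "sigma_inv i = Crossing i False"

definition q4 :: "piece list \<Rightarrow> piece list" where
  "q4 w = w @ [Cup 2, Cup 0]"

text \<open>The directions \<open>d\<^sub>0\<close>, \<open>d\<^sub>1\<close> orient the two top arcs, and thereby the whole plat.\<close>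

definition p4 :: "bool \<Rightarrow> bool \<Rightarrow> piece list \<Rightarrow> piece list" where
  "p4 d\<^sub>0 d\<^sub>1 w = [Cap 0 d\<^sub>0, Cap 2 d\<^sub>1] @ q4 w"

definition induced_orientation :: "bool \<Rightarrow> bool \<Rightarrow> bool list" where
  "induced_orientation d\<^sub>0 d\<^sub>1 = [d\<^sub>0, \<not> d\<^sub>0, d\<^sub>1, \<not> d\<^sub>1]"

definition T_infinity :: "piece list" where
  "T_infinity = q4 []"

definition T_zero :: "piece list" where
  "T_zero = [Cup 1, Cup 0]"

definition T_x :: "piece list" where
  "T_x = q4 [sigma 1]"

text \<open>
  The orientation of \<open>T_zero\<close>, \<open>T_infinity\<close>, \<open>T_x\<close> is determined by the orientation \<open>u\<close> of the
  endpoints, if a compatible one exists.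
\<close>

definition tangle_HOMFLY ::
  "bool list \<Rightarrow> piece list \<Rightarrow> laurent \<Rightarrow> laurent \<Rightarrow> laurent \<Rightarrow> bool" where
  "tangle_HOMFLY u D f g h \<longleftrightarrow>
     (\<not> tangle u [] T_zero \<longrightarrow> f = 0) \<and>
     (\<not> tangle u [] T_infinity \<longrightarrow> g = 0) \<and>
     (\<not> tangle u [] T_x \<longrightarrow> h = 0) \<and>
     skein_eq u [] (Poly_Mapping.single D 1)
       (Poly_Mapping.single T_zero f + Poly_Mapping.single T_infinity g + Poly_Mapping.single T_x h)"


subsection \<open>2-bridge knots\<close>

text \<open>The point \<open>(t, j)\<close> lies on strand \<open>j\<close> at the height just below the first \<open>t\<close> pieces.\<close>

definition points :: "piece list \<Rightarrow> (nat \<times> nat) set" where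
  "points D = {(t, j). t \<le> length D \<and> (\<exists>u. run [] (take t D) = Some u \<and> j < length u)}"

fun arc :: "piece \<Rightarrow> nat \<Rightarrow> nat \<times> nat \<Rightarrow> nat \<times> nat \<Rightarrow> bool" where
  "arc (Crossing i s) t x y \<longleftrightarrow>
     (\<exists>j. x = (t, j) \<and> y = (t + 1, if j = i then i + 1 else if j = i + 1 then i else j))"
| "arc (Cap i d) t x y \<longleftrightarrow>
     x = (t + 1, i) \<and> y = (t + 1, i + 1) \<or>
     (\<exists>j. x = (t, j) \<and> y = (t + 1, if j < i then j else j + 2))"
| "arc (Cup i) t x y \<longleftrightarrow>
     x = (t, i) \<and> y = (t, i + 1) \<or>
     (\<exists>j. x = (t, if j < i then j else j + 2) \<and> y = (t + 1, j))"

definition adjacent :: "piece list \<Rightarrow> nat \<times> nat \<Rightarrow> nat \<times> nat \<Rightarrow> bool" where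
  "adjacent D x y \<longleftrightarrow> x \<in> points D \<and> y \<in> points D \<and> (\<exists>t < length D. arc (D ! t) t x y)"

definition knot :: "piece list \<Rightarrow> bool" where
  "knot D \<longleftrightarrow> link D \<and> points D \<noteq> {} \<and>
     (\<forall>x \<in> points D. \<forall>y \<in> points D. equivclp (adjacent D) x y)"

definition bridge_number :: "piece list \<Rightarrow> nat" where
  "bridge_number D = (LEAST b. \<exists>D'. isotopic [] [] D D' \<and> b = length (filter is_Cap D'))"

definition two_bridge_knot :: "piece list \<Rightarrow> bool" where
  "two_bridge_knot D \<longleftrightarrow> knot D \<and> bridge_number D = 2"


subsection \<open>Alternating words and the matrices\<close>

definition block :: "(nat \<Rightarrow> nat) \<Rightarrow> nat \<Rightarrow> piece list" where
  "block \<epsilon> i = replicate (\<epsilon> i) (if odd i then sigma 1 else sigma_inv 2)"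

definition alternating_word :: "(nat \<Rightarrow> nat) \<Rightarrow> nat \<Rightarrow> piece list" where
  "alternating_word \<epsilon> N = concat (map (block \<epsilon>) [1..<N + 1])"

text \<open>
  The orientation type is read off at the top of the \<open>i\<close>-th block, where the two strands twisted
  in the block are in positions 1, 2 or 2, 3. It is the same at every crossing of the block.
\<close>

definition block_type :: "bool list \<Rightarrow> (nat \<Rightarrow> nat) \<Rightarrow> nat \<Rightarrow> nat" where
  "block_type u \<epsilon> i =
     (let v = the (run u (alternating_word \<epsilon> (i - 1)));
          j = (if odd i then 1 else 2)
      in if v ! j = v ! (j + 1) then 1 else 2)"

definition A_mat :: "nat \<Rightarrow> laurent mat" where
  "A_mat k =
     (if k = 1 then mat_of_rows_list 3
        [[1, 0, 0],
         [0, 0, - apow (-2)],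
         [0, 1, - (apow (-1) * mpow 1)]]
      else mat_of_rows_list 3
        [[1, 0, - (apow 1 * mpow 1)],
         [0, 0, - apow 2],
         [0, 1, 0]])"

definition B_inv_mat :: "nat \<Rightarrow> laurent mat" where
  "B_inv_mat k =
     (if k = 1 then mat_of_rows_list 3
        [[0, 0, - apow 2],
         [0, 1, 0],
         [1, 0, - (apow 1 * mpow 1)]]
      else mat_of_rows_list 3
        [[0, 0, - apow (-2)],
         [0, 1, - (apow (-1) * mpow 1)],
         [1, 0, 0]])"

definition M_mat :: "nat \<Rightarrow> (nat \<Rightarrow> nat) \<Rightarrow> (nat \<Rightarrow> nat) \<Rightarrow> laurent mat" where
  "M_mat N \<epsilon> k =
     foldr (*) (map (\<lambda>i. (if odd i then A_mat (k i) else B_inv_mat (k i)) ^\<^sub>m \<epsilon> i) [1..<N + 1]) (1\<^sub>m 3)"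

end

theory Submission
  imports Defs
begin

text \<open>
  Placing a fixed diagram above a tangle induces a linear map of skein modules. Hence it suffices to
  expand \<open>\<sigma>\<^sub>1\<close> and \<open>\<sigma>\<^sub>2\<^sup>-\<^sup>1\<close>, placed on top of each of \<open>T_zero\<close>, \<open>T_infinity\<close>, \<open>T_x\<close>, in these three
  tangles: the coefficient vectors are the columns of the matrices \<open>A\<close> and \<open>B\<close>, and only the
  column of \<open>T_x\<close> needs a skein relation. Reading the word from the bottom up, each crossing
  multiplies the coefficient vector by its matrix from the left, starting with \<open>T_infinity\<close>, whose
  vector is the second unit vector. Closing up linearly sends \<open>T_zero\<close> and \<open>T_x\<close> to the unknot and
  \<open>T_infinity\<close> to the two-component unlink.
\<close>

section \<open>Laurent monomials and linear maps out of a free module\<close>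

lemma apow_mult: "apow i * apow j = apow (i + j)"
  by (simp add: apow_def mult_single)

lemma mpow_mult: "mpow i * mpow j = mpow (i + j)"
  by (simp add: mpow_def mult_single)

lemma apow_0: "apow 0 = 1"
  by (simp add: apow_def flip: zero_prod_def)

lemma mpow_0: "mpow 0 = 1"
  by (simp add: mpow_def flip: zero_prod_def)

text \<open>The linear map determined by the values \<open>F\<close> on the basis. The action
  \<open>s\<close> of the target is a parameter because two targets occur: the free module on
  diagrams, with \<open>scale\<close>, and the Laurent ring acting on itself, for evaluating a
  HOMFLY polynomial.\<close>

definition linear_extension ::
  "('r::comm_ring_1 \<Rightarrow> 'b \<Rightarrow> 'b) \<Rightarrow> ('a \<Rightarrow> 'b::ab_group_add) \<Rightarrow> ('a \<Rightarrow>\<^sub>0 'r) \<Rightarrow> 'b" where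
  "linear_extension s F x = (\<Sum>D \<in> Poly_Mapping.keys x. s (Poly_Mapping.lookup x D) (F D))"

context Modules.module
begin

text \<open>Keys outside the support carry coefficient zero. Enlarging the index set allows sums
  over different supports to be compared termwise.\<close>

lemma linear_extension_superset:
  assumes "finite S" "Poly_Mapping.keys x \<subseteq> S"
  shows "linear_extension scale F x = (\<Sum>D \<in> S. scale (Poly_Mapping.lookup x D) (F D))"
  unfolding linear_extension_def using assms
  by (intro sum.mono_neutral_left) (auto simp: in_keys_iff)

lemma linear_extension_single:
  "linear_extension scale F (Poly_Mapping.single D c) = scale c (F D)"
  by (subst linear_extension_superset[of "{D}"]) auto

lemma linear_extension_zero: "linear_extension scale F 0 = 0"
  by (simp add: linear_extension_def)

lemma linear_extension_add:
  "linear_extension scale F (x + y) = linear_extension scale F x + linear_extension scale F y"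
proof -
  let ?S = "Poly_Mapping.keys x \<union> Poly_Mapping.keys y"
  have "Poly_Mapping.keys (x + y) \<subseteq> ?S"
    by (rule Poly_Mapping.keys_add)
  then show ?thesis
    by (simp add: linear_extension_superset[of ?S] lookup_add scale_left_distrib sum.distrib)
qed

lemma linear_extension_diff:
  "linear_extension scale F (x - y) = linear_extension scale F x - linear_extension scale F y"
  using linear_extension_add[of F "x - y" y] by simp

end

text \<open>Stated outside the locale because two actions meet here: \<open>scale\<close> on the
  source and \<open>s\<close> on the target.\<close>

lemma linear_extension_scale:
  assumes "Modules.module s"
  shows "linear_extension s F (scale c x) = s c (linear_extension s F x)"
proof -
  interpret M: Modules.module s by fact
  have "Poly_Mapping.keys (scale c x) \<subseteq> Poly_Mapping.keys x"
    by (auto simp: in_keys_iff lookup_scale)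
  then show ?thesis
    by (simp add: M.linear_extension_superset[of "Poly_Mapping.keys x"] lookup_scale
        M.scale_sum_right)
qed

text \<open>The criterion for a linear map to descend to quotients: only generators need checking.
  It is applied with the skein relations of the larger diagrams as \<open>T\<close>, and with
  \<open>{0}\<close> as \<open>T\<close>.\<close>

lemma linear_extension_span:
  assumes "Modules.module s" "x \<in> skein.span S" "\<And>y. y \<in> S \<Longrightarrow> linear_extension s F y \<in> T"
  shows "linear_extension s F x \<in> Modules.module.span s T"
proof -
  interpret M: Modules.module s by fact
  from assms(2) show ?thesis
  proof (induction rule: skein.span_induct_alt)
    case base
    show ?case by (simp add: M.linear_extension_zero M.span_zero)
  next
    case (step c y z)
    then show ?case
      by (simp add: M.linear_extension_add linear_extension_scale[OF assms(1)] assms(3)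
          M.span_add M.span_scale M.span_base)
  qed
qed


section \<open>Placing a diagram above\<close>

lemma run_append: "run u (X @ Y) = Option.bind (run u X) (\<lambda>v. run v Y)"
  by (induction X arbitrary: u) (auto split: Option.bind_splits)

lemma tangle_append: "run u X = Some u' \<Longrightarrow> tangle u v (X @ D) \<longleftrightarrow> tangle u' v D"
  by (simp add: tangle_def run_append)

text \<open>The diagram \<open>X\<close> is absorbed into the untouched part above the local
  move.\<close>

lemma isotopy_step_append:
  assumes "run u X = Some u'" "isotopy_step u' v D D'"
  shows "isotopy_step u v (X @ D) (X @ D')"
proof -
  from assms(2) obtain Z l r Y where *: "tangle u' v D" "tangle u' v D'" "local_move l r"
    "D = Z @ l @ Y" "D' = Z @ r @ Y" "run u' (Z @ l) = run u' (Z @ r)"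
    unfolding isotopy_step_def by blast
  show ?thesis
    unfolding isotopy_step_def
  proof (intro conjI exI)
    show "X @ D = (X @ Z) @ l @ Y" "X @ D' = (X @ Z) @ r @ Y" using * by simp_all
    show "run u ((X @ Z) @ l) = run u ((X @ Z) @ r)"
      using * assms(1) by (simp add: run_append)
  qed (use * assms(1) in \<open>simp_all add: tangle_append\<close>)
qed

lemma isotopic_append:
  assumes "run u X = Some u'" "isotopic u' v D D'"
  shows "isotopic u v (X @ D) (X @ D')"
proof -
  from assms(2) have "equivclp (isotopy_step u' v) D D'" by (simp add: isotopic_def)
  then have "equivclp (isotopy_step u v) (X @ D) (X @ D')"
  proof (induction rule: equivclp_induct)
    case base
    show ?case by simp
  next
    case (step E E')
    then show ?case
      using isotopy_step_append[OF assms(1)] equivclp_into_equivclp by metis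
  qed
  then show ?thesis
    using assms by (simp add: isotopic_def tangle_append)
qed

text \<open>An introduction form in which the sign of the crossing is computed from the orientation
  \<open>x\<close> just above it.\<close>

lemma skein_tripleI:
  assumes "run u X = Some x" "i + 1 < length x"
    and "tangle u v (X @ [Crossing i (x ! i = x ! (i + 1))] @ Y)"
  shows "skein_triple u v (X @ [Crossing i (x ! i = x ! (i + 1))] @ Y)
    (X @ [Crossing i (x ! i \<noteq> x ! (i + 1))] @ Y)
    (X @ (if x ! i = x ! (i + 1) then [] else [Cup i, Cap i (x ! (i + 1))]) @ Y)"
  using assms unfolding skein_triple_def by blast

lemma skein_triple_append:
  assumes "run u X = Some u'" "skein_triple u' v Lp Lm L0"
  shows "skein_triple u v (X @ Lp) (X @ Lm) (X @ L0)"
proof -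
  from assms(2) obtain Z Y x i where *: "tangle u' v Lp" "run u' Z = Some x" "i + 1 < length x"
    "Lp = Z @ [Crossing i (x ! i = x ! (i + 1))] @ Y"
    "Lm = Z @ [Crossing i (\<not> (x ! i = x ! (i + 1)))] @ Y"
    "L0 = Z @ (if x ! i = x ! (i + 1) then [] else [Cup i, Cap i (x ! (i + 1))]) @ Y"
    unfolding skein_triple_def by blast
  then show ?thesis
    using skein_tripleI[of u "X @ Z" x i v Y] assms(1) by (simp add: run_append tangle_append)
qed

section \<open>Isotopy as an equivalence relation\<close>

lemma isotopic_refl: "tangle u v D \<Longrightarrow> isotopic u v D D"
  by (simp add: isotopic_def)

lemma isotopic_sym: "isotopic u v D D' \<Longrightarrow> isotopic u v D' D"
proof -
  assume *: "isotopic u v D D'"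
  then have "equivclp (isotopy_step u v) D D'" by (simp add: isotopic_def)
  then have "tangle u v D'"
    by (induction rule: equivclp_induct)
      (use * in \<open>auto simp: isotopic_def isotopy_step_def\<close>)
  then show ?thesis using * by (auto simp: isotopic_def intro: equivclp_sym)
qed

lemma isotopic_trans [trans]: "isotopic u v D D' \<Longrightarrow> isotopic u v D' D'' \<Longrightarrow> isotopic u v D D''"
  by (auto simp: isotopic_def intro: equivclp_trans)

text \<open>Equality of the orientations below the two sides of the move lets the common remainder
  \<open>Y\<close> run identically, so the second diagram is automatically a tangle as well.\<close>

lemma isotopic_local_move:
  assumes "local_move l r" "tangle u v (X @ l @ Y)" "run u (X @ l) = run u (X @ r)"
  shows "isotopic u v (X @ l @ Y) (X @ r @ Y)"
proof -
  have "tangle u v (X @ r @ Y)"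
    using assms run_append[of u "X @ l" Y] run_append[of u "X @ r" Y] by (simp add: tangle_def)
  then have "isotopy_step u v (X @ l @ Y) (X @ r @ Y)"
    using assms unfolding isotopy_step_def by blast
  then show ?thesis
    using assms(2) by (auto simp: isotopic_def)
qed


section \<open>Calculus in the skein module\<close>

lemma skein_eq_refl: "skein_eq u v x x"
  by (simp add: skein_eq_def skein.span_zero)

lemma skein_eq_trans: "skein_eq u v x y \<Longrightarrow> skein_eq u v y z \<Longrightarrow> skein_eq u v x z"
  using skein.span_add[of "x - y" _ "y - z"] by (auto simp: skein_eq_def)

lemma skein_eq_add:
  "skein_eq u v x y \<Longrightarrow> skein_eq u v x' y' \<Longrightarrow> skein_eq u v (x + x') (y + y')"
  using skein.span_add[of "x - y" _ "x' - y'"] by (auto simp: skein_eq_def algebra_simps)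

lemma scale_single: "scale c (Poly_Mapping.single D b) = Poly_Mapping.single D (c * b)"
  by (rule poly_mapping_eqI) (simp add: lookup_scale lookup_single when_def)

lemma skein_eq_isotopic:
  assumes "isotopic u v D D'"
  shows "skein_eq u v (Poly_Mapping.single D c) (Poly_Mapping.single D' c)"
proof -
  have "scale c (Poly_Mapping.single D 1 - Poly_Mapping.single D' 1)
      \<in> skein.span (skein_relations u v)"
    using assms by (intro skein.span_scale skein.span_base) (auto simp: skein_relations_def)
  then show ?thesis
    by (simp add: skein_eq_def skein.scale_right_diff_distrib scale_single)
qed

lemma skein_relation_scaled:
  assumes "skein_triple u v Lp Lm L0"
  shows "Poly_Mapping.single Lp (c * apow 1) + Poly_Mapping.single Lm (c * apow (-1))
    + Poly_Mapping.single L0 (c * mpow 1) \<in> skein.span (skein_relations u v)"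
proof -
  have "scale c (Poly_Mapping.single Lp (apow 1) + Poly_Mapping.single Lm (apow (-1))
      + Poly_Mapping.single L0 (mpow 1)) \<in> skein.span (skein_relations u v)"
    using assms unfolding skein_relations_def
    by (intro skein.span_scale skein.span_base) blast
  then show ?thesis
    by (simp add: skein.scale_right_distrib scale_single)
qed

text \<open>The skein relation multiplied by the inverse of \<open>a\<close> and solved for the
  positive crossing.\<close>

lemma skein_eq_positive:
  assumes "skein_triple u v Lp Lm L0"
  shows "skein_eq u v (Poly_Mapping.single Lp c)
    (Poly_Mapping.single Lm (- apow (-2) * c) + Poly_Mapping.single L0 (- (apow (-1) * mpow 1) * c))"
  using skein_relation_scaled[OF assms, of "c * apow (-1)"]
  by (simp add: skein_eq_def apow_mult apow_0 mult.assoc single_uminus algebra_simps)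

text \<open>The skein relation multiplied by \<open>a\<close> and solved for the negative
  crossing.\<close>

lemma skein_eq_negative:
  assumes "skein_triple u v Lp Lm L0"
  shows "skein_eq u v (Poly_Mapping.single Lm c)
    (Poly_Mapping.single Lp (- apow 2 * c) + Poly_Mapping.single L0 (- (apow 1 * mpow 1) * c))"
  using skein_relation_scaled[OF assms, of "c * apow 1"]
  by (simp add: skein_eq_def apow_mult apow_0 mult.assoc single_uminus algebra_simps)

text \<open>Isotopies and skein triples both survive placing \<open>X\<close> on top, so the induced
  linear map sends relations to relations.\<close>

lemma skein_eq_append:
  assumes "run u X = Some u'" "skein_eq u' v x y"
  shows "skein_eq u v
    (linear_extension scale (\<lambda>D. Poly_Mapping.single (X @ D) 1) x)
    (linear_extension scale (\<lambda>D. Poly_Mapping.single (X @ D) 1) y)"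
proof -
  let ?L = "linear_extension scale (\<lambda>D. Poly_Mapping.single (X @ D) (1 :: laurent))"
  have "?L (x - y) \<in> skein.span (skein_relations u v)"
  proof (rule linear_extension_span)
    show "Modules.module scale" by (rule skein.module_axioms)
    show "x - y \<in> skein.span (skein_relations u' v)"
      using assms(2) by (simp add: skein_eq_def)
    fix z assume "z \<in> skein_relations u' v"
    then consider
      (iso) D D' where "z = Poly_Mapping.single D 1 - Poly_Mapping.single D' 1" "isotopic u' v D D'"
    | (triple) Lp Lm L0 where "z = Poly_Mapping.single Lp (apow 1)
        + Poly_Mapping.single Lm (apow (-1)) + Poly_Mapping.single L0 (mpow 1)"
        "skein_triple u' v Lp Lm L0"
      unfolding skein_relations_def by blast
    then show "?L z \<in> skein_relations u v"
    proof cases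
      case iso
      then show ?thesis
        using isotopic_append[OF assms(1)] unfolding skein_relations_def
        by (simp add: skein.linear_extension_diff skein.linear_extension_single scale_single) blast
    next
      case triple
      then show ?thesis
        using skein_triple_append[OF assms(1)] unfolding skein_relations_def
        by (simp add: skein.linear_extension_add skein.linear_extension_single scale_single) blast
    qed
  qed
  then show ?thesis by (simp add: skein_eq_def skein.linear_extension_diff)
qed

text \<open>After closing up with \<open>X\<close>, a HOMFLY polynomial kills every skein relation
  by its defining properties. The image of the relation submodule therefore lies in the span of
  zero.\<close>

lemma skein_eq_HOMFLY:
  assumes "is_HOMFLY P" "run [] X = Some u" "skein_eq u [] x y"
  shows "linear_extension (*) (\<lambda>D. P (X @ D)) x = linear_extension (*) (\<lambda>D. P (X @ D)) y"
proof -
  interpret R: Modules.module "(*) :: laurent \<Rightarrow> laurent \<Rightarrow> laurent"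
    by unfold_locales (auto simp: algebra_simps)
  let ?L = "linear_extension (*) (\<lambda>D. P (X @ D))"
  have "?L (x - y) \<in> R.span {0}"
  proof (rule linear_extension_span)
    show "Modules.module ((*) :: laurent \<Rightarrow> laurent \<Rightarrow> laurent)" by (rule R.module_axioms)
    show "x - y \<in> skein.span (skein_relations u [])"
      using assms(3) by (simp add: skein_eq_def)
    fix z assume "z \<in> skein_relations u []"
    then consider
      (iso) D D' where "z = Poly_Mapping.single D 1 - Poly_Mapping.single D' 1" "isotopic u [] D D'"
    | (triple) Lp Lm L0 where "z = Poly_Mapping.single Lp (apow 1)
        + Poly_Mapping.single Lm (apow (-1)) + Poly_Mapping.single L0 (mpow 1)"
        "skein_triple u [] Lp Lm L0"
      unfolding skein_relations_def by blast
    then show "?L z \<in> {0}"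
    proof cases
      case iso
      then have "P (X @ D) = P (X @ D')"
        using isotopic_append[OF assms(2)] assms(1) unfolding is_HOMFLY_def by blast
      then show ?thesis
        by (simp add: iso R.linear_extension_diff R.linear_extension_single)
    next
      case triple
      then show ?thesis
        using skein_triple_append[OF assms(2) triple(2)] assms(1) unfolding is_HOMFLY_def
        by (simp add: R.linear_extension_add R.linear_extension_single)
    qed
  qed
  then show ?thesis
    by (simp add: R.linear_extension_diff R.span_insert)
qed

text \<open>The skein relation is applied to the upper of two equal crossings. Switching it makes
  the pair cancel by \<open>R2\<close>. Smoothing it leaves a single crossing if the strands are
  parallel; otherwise it leaves a minimum above a maximum with a kink, which R1 removes. The
  exponent \<open>e\<close> is -1 when the crossing is positive and 1 when it is negative.\<close>

lemma skein_eq_double_crossing: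
  fixes u :: "bool list" and i :: nat and s :: bool
  defines "parallel \<equiv> u ! i = u ! (i + 1)"
  defines "e \<equiv> if s = parallel then - 1 else 1"
  assumes tangle: "tangle u v (Crossing i s # Crossing i s # D)"
  shows "skein_eq u v (Poly_Mapping.single (Crossing i s # Crossing i s # D) c)
    (Poly_Mapping.single D (- apow (2 * e) * c) +
     Poly_Mapping.single (if parallel then Crossing i s # D else Cup i # Cap i (u ! i) # D)
       (- (apow e * mpow 1) * c))"
proof -
  let ?L = "Crossing i s # Crossing i s # D"
  let ?L' = "Crossing i (\<not> s) # Crossing i s # D"
  let ?S = "if parallel then [] else [Cup i, Cap i (u ! (i + 1))]"
  let ?smoothing = "?S @ Crossing i s # D"
  let ?reduced = "if parallel then Crossing i s # D else Cup i # Cap i (u ! i) # D"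
  have len: "i + 1 < length u"
    using tangle by (simp add: tangle_def split: if_splits)
  \<comment> \<open>Splitting \<open>u\<close> at the crossing makes \<open>run\<close> computable
    by simplification.\<close>
  then obtain xs p q ys where u: "u = xs @ p # q # ys" "i = length xs"
    using that[of "take i u" "u ! i" "u ! (i + 1)" "drop (i + 2) u"]
    by (simp add: Cons_nth_drop_Suc flip: id_take_nth_drop)
  have tangle': "tangle u v ?L'"
    using tangle by (simp add: tangle_def)
  have swap: "run u [Crossing i (\<not> s), Crossing i s] = Some u"
    by (simp add: u nth_append)
  have "isotopic u v ([] @ [Crossing i (\<not> s), Crossing i (\<not> \<not> s)] @ D) ([] @ [] @ D)"
    using tangle' swap by (intro isotopic_local_move local_move.R2) simp_all
  then have iso': "isotopic u v ?L' D" by simp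
  have iso0: "isotopic u v ?smoothing ?reduced"
  proof (cases parallel)
    case True
    then have "run u [Crossing i s] = Some u"
      by (simp add: parallel_def u nth_append)
    then have "tangle u v (Crossing i s # D)"
      using tangle tangle_append[of u "[Crossing i s]" u v "Crossing i s # D"] by simp
    then show ?thesis using True by (simp add: isotopic_refl)
  next
    case False
    \<comment> \<open>Removing the kink at the maximum reverses its label from
      \<open>u ! (i + 1)\<close> to the opposite direction, which is \<open>u ! i\<close> because
      the strands are antiparallel.\<close>
    have "isotopic u v ([Cup i] @ [Cap i (u ! (i + 1)), Crossing i s] @ D)
        ([Cup i] @ [Cap i (\<not> u ! (i + 1))] @ D)"
    proof (rule isotopic_local_move[OF local_move.R1_Cap])
      show "run u ([Cup i] @ [Cap i (u ! (i + 1)), Crossing i s])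
          = run u ([Cup i] @ [Cap i (\<not> u ! (i + 1))])"
        using False by (simp add: parallel_def u nth_append)
      show "tangle u v ([Cup i] @ [Cap i (u ! (i + 1)), Crossing i s] @ D)"
        using tangle False by (simp add: tangle_def parallel_def u nth_append)
    qed
    moreover have "(\<not> u ! (i + 1)) = u ! i" using False by (auto simp: parallel_def)
    ultimately show ?thesis using False by simp
  qed
  \<comment> \<open>One triple serves both signs: the given diagram is its positive member if
    \<open>s = parallel\<close> and its negative member otherwise.\<close>
  have triple: "skein_triple u v (Crossing i parallel # Crossing i s # D)
      (Crossing i (\<not> parallel) # Crossing i s # D) ?smoothing"
    using skein_tripleI[of u "[]" u i v "Crossing i s # D"] tangle tangle' len
    by (cases "s = parallel") (simp_all add: parallel_def)
  show ?thesis
  proof (cases "s = parallel")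
    case True
    with triple have "skein_triple u v ?L ?L' ?smoothing" by simp
    from skein_eq_trans[OF skein_eq_positive[OF this]
        skein_eq_add[OF skein_eq_isotopic[OF iso'] skein_eq_isotopic[OF iso0]]]
    show ?thesis using True by (simp add: e_def)
  next
    case False
    then have "parallel = (\<not> s)" by auto
    with triple have "skein_triple u v ?L' ?L ?smoothing" by simp
    from skein_eq_trans[OF skein_eq_negative[OF this]
        skein_eq_add[OF skein_eq_isotopic[OF iso'] skein_eq_isotopic[OF iso0]]]
    show ?thesis using False by (simp add: e_def)
  qed
qed


section \<open>Adding a crossing on top of the basic tangles\<close>

lemma tangle_T_zero: "tangle [p, q, r, s] [] T_zero \<longleftrightarrow> q \<noteq> r \<and> p \<noteq> s"
  by (auto simp: tangle_def T_zero_def)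

lemma tangle_T_infinity: "tangle [p, q, r, s] [] T_infinity \<longleftrightarrow> p \<noteq> q \<and> r \<noteq> s"
  by (auto simp: tangle_def T_infinity_def q4_def)

lemma tangle_T_x: "tangle [p, q, r, s] [] T_x \<longleftrightarrow> p \<noteq> r \<and> q \<noteq> s"
  by (auto simp: tangle_def T_x_def q4_def sigma_def)

lemma skein_eq_Cons:
  assumes "tangle_HOMFLY u' D f g h" "step u c = Some u'"
  shows "skein_eq u [] (Poly_Mapping.single (c # D) 1)
    (Poly_Mapping.single (c # T_zero) f + Poly_Mapping.single (c # T_infinity) g
      + Poly_Mapping.single (c # T_x) h)"
proof -
  have "run u [c] = Some u'" using assms(2) by simp
  moreover have "skein_eq u' [] (Poly_Mapping.single D 1)
      (Poly_Mapping.single T_zero f + Poly_Mapping.single T_infinity g + Poly_Mapping.single T_x h)"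
    using assms(1) by (simp add: tangle_HOMFLY_def)
  ultimately have "skein_eq u []
      (linear_extension scale (\<lambda>D. Poly_Mapping.single ([c] @ D) 1) (Poly_Mapping.single D 1))
      (linear_extension scale (\<lambda>D. Poly_Mapping.single ([c] @ D) 1)
        (Poly_Mapping.single T_zero f + Poly_Mapping.single T_infinity g + Poly_Mapping.single T_x h))"
    by (rule skein_eq_append)
  then show ?thesis
    by (simp add: skein.linear_extension_add skein.linear_extension_single scale_single)
qed

text \<open>Each basic tangle needs rewriting only if its coefficient is nonzero, and a nonzero
  coefficient guarantees that the tangle is compatible with the orientation. The conditions that
  each replacement vanish at 0 take care of the remaining cases.\<close>

lemma skein_eq_combine:
  assumes "skein_eq u [] x (Poly_Mapping.single D\<^sub>1 f + Poly_Mapping.single D\<^sub>2 g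
      + Poly_Mapping.single D\<^sub>3 h)"
    and "f \<noteq> 0 \<Longrightarrow> skein_eq u [] (Poly_Mapping.single D\<^sub>1 f) (y\<^sub>1 f)"
    and "g \<noteq> 0 \<Longrightarrow> skein_eq u [] (Poly_Mapping.single D\<^sub>2 g) (y\<^sub>2 g)"
    and "h \<noteq> 0 \<Longrightarrow> skein_eq u [] (Poly_Mapping.single D\<^sub>3 h) (y\<^sub>3 h)"
    and "y\<^sub>1 0 = 0" "y\<^sub>2 0 = 0" "y\<^sub>3 0 = 0"
  shows "skein_eq u [] x (y\<^sub>1 f + y\<^sub>2 g + y\<^sub>3 h)"
proof -
  have "skein_eq u [] (Poly_Mapping.single D\<^sub>1 f) (y\<^sub>1 f)"
    using assms(2,5) by (cases "f = 0") (auto simp: skein_eq_refl)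
  moreover have "skein_eq u [] (Poly_Mapping.single D\<^sub>2 g) (y\<^sub>2 g)"
    using assms(3,6) by (cases "g = 0") (auto simp: skein_eq_refl)
  moreover have "skein_eq u [] (Poly_Mapping.single D\<^sub>3 h) (y\<^sub>3 h)"
    using assms(4,7) by (cases "h = 0") (auto simp: skein_eq_refl)
  ultimately show ?thesis
    using assms(1) by (blast intro: skein_eq_trans skein_eq_add)
qed

text \<open>Parallel strands in positions 1 and 2 cannot be joined by a minimum, so
  \<open>T_zero\<close> has coefficient zero. The crossing turns \<open>T_infinity\<close> into
  \<open>T_x\<close> by definition and \<open>T_x\<close> into a positive double crossing.\<close>

lemma tangle_HOMFLY_sigma_parallel:
  assumes "tangle_HOMFLY [p, q, q, s] D f g h"
  shows "tangle_HOMFLY [p, q, q, s] (sigma 1 # D)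
    f (- apow (-2) * h) (g - apow (-1) * mpow 1 * h)"
proof -
  let ?u = "[p, q, q, s]"
  have compat: "\<not> tangle ?u [] T_zero \<Longrightarrow> f = 0" "\<not> tangle ?u [] T_infinity \<Longrightarrow> g = 0"
    "\<not> tangle ?u [] T_x \<Longrightarrow> h = 0"
    using assms by (auto simp: tangle_HOMFLY_def)
  have "skein_eq ?u [] (Poly_Mapping.single (sigma 1 # D) 1)
     (Poly_Mapping.single T_zero f + Poly_Mapping.single T_x g +
       (Poly_Mapping.single T_infinity (- apow (-2) * h)
         + Poly_Mapping.single T_x (- (apow (-1) * mpow 1) * h)))"
  proof (rule skein_eq_combine[OF skein_eq_Cons[OF assms]])
    show "step ?u (sigma 1) = Some ?u" by (simp add: sigma_def)
    show "skein_eq ?u [] (Poly_Mapping.single (sigma 1 # T_zero) f) (Poly_Mapping.single T_zero f)"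
      if "f \<noteq> 0"
      using that compat(1) tangle_T_zero[of p q q s] by auto
    show "skein_eq ?u [] (Poly_Mapping.single (sigma 1 # T_infinity) g) (Poly_Mapping.single T_x g)"
      by (simp add: T_x_def T_infinity_def q4_def skein_eq_refl)
    show "skein_eq ?u [] (Poly_Mapping.single (sigma 1 # T_x) h)
        (Poly_Mapping.single T_infinity (- apow (-2) * h)
          + Poly_Mapping.single T_x (- (apow (-1) * mpow 1) * h))" if "h \<noteq> 0"
    proof -
      have "p \<noteq> q" "q \<noteq> s" using that compat(3) by (auto simp: tangle_T_x)
      then have "tangle ?u [] (Crossing 1 True # Crossing 1 True # T_infinity)"
        by (auto simp: tangle_def T_infinity_def q4_def)
      from skein_eq_double_crossing[OF this, of h] show ?thesis
        by (simp add: T_x_def T_infinity_def q4_def sigma_def)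
    qed
  qed simp_all
  then show ?thesis
    using compat unfolding tangle_HOMFLY_def
    by (auto simp: tangle_T_zero tangle_T_infinity tangle_T_x single_add single_diff single_uminus
        algebra_simps)
qed

text \<open>Here the crossing exchanges the directions of two endpoints, so the orientations above
  and below it differ. On \<open>T_zero\<close> it is a removable kink. On \<open>T_x\<close> the
  double crossing is negative, and its smoothing straightens to \<open>T_zero\<close>.\<close>

lemma tangle_HOMFLY_sigma_antiparallel:
  assumes "tangle_HOMFLY [p, \<not> q, q, s] D f g h"
  shows "tangle_HOMFLY [p, q, \<not> q, s] (sigma 1 # D)
    (f - apow 1 * mpow 1 * h) (- apow 2 * h) g"
proof -
  let ?u = "[p, q, \<not> q, s]" and ?u' = "[p, \<not> q, q, s]"
  have compat: "\<not> tangle ?u' [] T_zero \<Longrightarrow> f = 0" "\<not> tangle ?u' [] T_infinity \<Longrightarrow> g = 0"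
    "\<not> tangle ?u' [] T_x \<Longrightarrow> h = 0"
    using assms by (auto simp: tangle_HOMFLY_def)
  have "skein_eq ?u [] (Poly_Mapping.single (sigma 1 # D) 1)
     (Poly_Mapping.single T_zero f + Poly_Mapping.single T_x g +
       (Poly_Mapping.single T_infinity (- apow 2 * h)
         + Poly_Mapping.single T_zero (- (apow 1 * mpow 1) * h)))"
  proof (rule skein_eq_combine[OF skein_eq_Cons[OF assms]])
    show "step ?u (sigma 1) = Some ?u'" by (simp add: sigma_def)
    show "skein_eq ?u [] (Poly_Mapping.single (sigma 1 # T_zero) f) (Poly_Mapping.single T_zero f)"
      if "f \<noteq> 0"
    proof -
      have "p \<noteq> s" using that compat(1) by (auto simp: tangle_T_zero)
      then have "isotopic ?u [] ([] @ [Crossing 1 True, Cup 1] @ [Cup 0]) ([] @ [Cup 1] @ [Cup 0])"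
        by (intro isotopic_local_move local_move.R1_Cup) (auto simp: tangle_def)
      then show ?thesis
        by (intro skein_eq_isotopic) (simp add: T_zero_def sigma_def)
    qed
    show "skein_eq ?u [] (Poly_Mapping.single (sigma 1 # T_infinity) g) (Poly_Mapping.single T_x g)"
      by (simp add: T_x_def T_infinity_def q4_def skein_eq_refl)
    show "skein_eq ?u [] (Poly_Mapping.single (sigma 1 # T_x) h)
        (Poly_Mapping.single T_infinity (- apow 2 * h)
          + Poly_Mapping.single T_zero (- (apow 1 * mpow 1) * h))" if "h \<noteq> 0"
    proof -
      have pq: "p \<noteq> q" "q = s" using that compat(3) by (auto simp: tangle_T_x)
      then have "tangle ?u [] (Crossing 1 True # Crossing 1 True # T_infinity)"
        by (auto simp: tangle_def T_infinity_def q4_def)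
      from skein_eq_double_crossing[OF this, of h]
      have *: "skein_eq ?u [] (Poly_Mapping.single (sigma 1 # T_x) h)
          (Poly_Mapping.single T_infinity (- apow 2 * h)
            + Poly_Mapping.single [Cup 1, Cap 1 q, Cup 2, Cup 0] (- (apow 1 * mpow 1) * h))"
        by (simp add: T_x_def T_infinity_def q4_def sigma_def)
      \<comment> \<open>The maximum created by the smoothing cancels against the minimum on its
        right, leaving the two nested arcs of \<open>T_zero\<close>.\<close>
      have "local_move [Cap 1 q, Cup 2] []"
        using local_move.zigzag_right[of 1 q] by (simp add: numeral_2_eq_2)
      then have "isotopic ?u [] ([Cup 1] @ [Cap 1 q, Cup 2] @ [Cup 0]) ([Cup 1] @ [] @ [Cup 0])"
        by (rule isotopic_local_move) (use pq in \<open>auto simp: tangle_def\<close>)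
      then have "isotopic ?u [] [Cup 1, Cap 1 q, Cup 2, Cup 0] T_zero"
        by (simp add: T_zero_def)
      with * show ?thesis
        by (rule skein_eq_trans[OF _ skein_eq_add[OF skein_eq_refl skein_eq_isotopic]])
    qed
  qed simp_all
  then show ?thesis
    using compat unfolding tangle_HOMFLY_def
    by (auto simp: tangle_T_zero tangle_T_infinity tangle_T_x single_add single_diff single_uminus
        algebra_simps)
qed

text \<open>The crossing slides past the minimum on its right. Consequently \<open>T_zero\<close>
  plays for \<open>sigma_inv 2\<close> the role that \<open>T_infinity\<close> plays for
  \<open>sigma 1\<close>.\<close>

lemma isotopic_T_x:
  assumes "tangle [p, q, r, s] [] T_x"
  shows "isotopic [p, q, r, s] [] (sigma_inv 2 # T_zero) T_x"
proof -
  have "local_move [Crossing 1 True, Cup 2] [Crossing 2 False, Cup 1]"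
    using local_move.slide_Cup[of 1 True] by (simp add: numeral_2_eq_2)
  then have "isotopic [p, q, r, s] [] ([] @ [Crossing 1 True, Cup 2] @ [Cup 0])
      ([] @ [Crossing 2 False, Cup 1] @ [Cup 0])"
    by (rule isotopic_local_move) (use assms in \<open>auto simp: tangle_def T_x_def q4_def sigma_def\<close>)
  from isotopic_sym[OF this] show ?thesis
    by (simp add: T_x_def T_zero_def q4_def sigma_def sigma_inv_def)
qed

text \<open>Now \<open>T_infinity\<close> is the excluded tangle, since it would join the parallel
  strands in positions 2 and 3. The crossings are negative.\<close>

lemma tangle_HOMFLY_sigma_inv_parallel:
  assumes "tangle_HOMFLY [p, q, r, r] D f g h"
  shows "tangle_HOMFLY [p, q, r, r] (sigma_inv 2 # D)
    (- apow 2 * h) g (f - apow 1 * mpow 1 * h)"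
proof -
  let ?u = "[p, q, r, r]"
  have compat: "\<not> tangle ?u [] T_zero \<Longrightarrow> f = 0" "\<not> tangle ?u [] T_infinity \<Longrightarrow> g = 0"
    "\<not> tangle ?u [] T_x \<Longrightarrow> h = 0"
    using assms by (auto simp: tangle_HOMFLY_def)
  have iso: "isotopic ?u [] (sigma_inv 2 # T_zero) T_x" if "p \<noteq> r" "q \<noteq> r"
    using isotopic_T_x[of p q r r] that by (simp add: tangle_T_x)
  have "skein_eq ?u [] (Poly_Mapping.single (sigma_inv 2 # D) 1)
     (Poly_Mapping.single T_x f + Poly_Mapping.single T_infinity g +
       (Poly_Mapping.single T_zero (- apow 2 * h)
         + Poly_Mapping.single T_x (- (apow 1 * mpow 1) * h)))"
  proof (rule skein_eq_combine[OF skein_eq_Cons[OF assms]])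
    show step: "step ?u (sigma_inv 2) = Some ?u" by (simp add: sigma_inv_def)
    show "skein_eq ?u [] (Poly_Mapping.single (sigma_inv 2 # T_zero) f) (Poly_Mapping.single T_x f)"
      if "f \<noteq> 0"
      using that compat(1) by (intro skein_eq_isotopic iso) (auto simp: tangle_T_zero)
    show "skein_eq ?u [] (Poly_Mapping.single (sigma_inv 2 # T_infinity) g)
        (Poly_Mapping.single T_infinity g)" if "g \<noteq> 0"
      using that compat(2) tangle_T_infinity[of p q r r] by auto
    show "skein_eq ?u [] (Poly_Mapping.single (sigma_inv 2 # T_x) h)
        (Poly_Mapping.single T_zero (- apow 2 * h)
          + Poly_Mapping.single T_x (- (apow 1 * mpow 1) * h))" if "h \<noteq> 0"
    proof -
      have pq: "p \<noteq> r" "q \<noteq> r" using that compat(3) by (auto simp: tangle_T_x)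
      then have "tangle ?u [] (Crossing 2 False # Crossing 2 False # T_zero)"
        by (auto simp: tangle_def T_zero_def)
      from skein_eq_double_crossing[OF this, of h]
      have *: "skein_eq ?u [] (Poly_Mapping.single (sigma_inv 2 # sigma_inv 2 # T_zero) h)
          (Poly_Mapping.single T_zero (- apow 2 * h)
            + Poly_Mapping.single (sigma_inv 2 # T_zero) (- (apow 1 * mpow 1) * h))"
        by (simp add: sigma_inv_def)
      \<comment> \<open>Rewriting \<open>T_x\<close> as \<open>sigma_inv 2\<close> above
        \<open>T_zero\<close> puts both crossings in the same position, as the double crossing lemma
        requires.\<close>
      have "isotopic ?u [] (sigma_inv 2 # T_x) (sigma_inv 2 # sigma_inv 2 # T_zero)"
        using isotopic_append[of ?u "[sigma_inv 2]" ?u] isotopic_sym[OF iso[OF pq]] step by simp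
      from skein_eq_isotopic[OF this] * skein_eq_add[OF skein_eq_refl skein_eq_isotopic[OF iso[OF pq]]]
      show ?thesis by (rule skein_eq_trans[OF skein_eq_trans])
    qed
  qed simp_all
  then show ?thesis
    using compat unfolding tangle_HOMFLY_def
    by (auto simp: tangle_T_zero tangle_T_infinity tangle_T_x single_add single_diff single_uminus
        algebra_simps)
qed

text \<open>The kink now sits on \<open>T_infinity\<close>. The double crossing obtained from
  \<open>T_x\<close> is positive, and its smoothing straightens to
  \<open>T_infinity\<close>.\<close>

lemma tangle_HOMFLY_sigma_inv_antiparallel:
  assumes "tangle_HOMFLY [p, q, \<not> r, r] D f g h"
  shows "tangle_HOMFLY [p, q, r, \<not> r] (sigma_inv 2 # D)
    (- apow (-2) * h) (g - apow (-1) * mpow 1 * h) f"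
proof -
  let ?u = "[p, q, r, \<not> r]" and ?u' = "[p, q, \<not> r, r]"
  have compat: "\<not> tangle ?u' [] T_zero \<Longrightarrow> f = 0" "\<not> tangle ?u' [] T_infinity \<Longrightarrow> g = 0"
    "\<not> tangle ?u' [] T_x \<Longrightarrow> h = 0"
    using assms by (auto simp: tangle_HOMFLY_def)
  have "skein_eq ?u [] (Poly_Mapping.single (sigma_inv 2 # D) 1)
     (Poly_Mapping.single T_x f + Poly_Mapping.single T_infinity g +
       (Poly_Mapping.single T_zero (- apow (-2) * h)
         + Poly_Mapping.single T_infinity (- (apow (-1) * mpow 1) * h)))"
  proof (rule skein_eq_combine[OF skein_eq_Cons[OF assms]])
    show step: "step ?u (sigma_inv 2) = Some ?u'" by (simp add: sigma_inv_def)
    show "skein_eq ?u [] (Poly_Mapping.single (sigma_inv 2 # T_zero) f) (Poly_Mapping.single T_x f)"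
      if "f \<noteq> 0"
      using that compat(1)
      by (intro skein_eq_isotopic isotopic_T_x) (auto simp: tangle_T_zero tangle_T_x)
    show "skein_eq ?u [] (Poly_Mapping.single (sigma_inv 2 # T_infinity) g)
        (Poly_Mapping.single T_infinity g)" if "g \<noteq> 0"
    proof -
      have "p \<noteq> q" using that compat(2) by (auto simp: tangle_T_infinity)
      then have "isotopic ?u [] ([] @ [Crossing 2 False, Cup 2] @ [Cup 0]) ([] @ [Cup 2] @ [Cup 0])"
        by (intro isotopic_local_move local_move.R1_Cup) (auto simp: tangle_def)
      then show ?thesis
        by (intro skein_eq_isotopic) (simp add: T_infinity_def q4_def sigma_inv_def)
    qed
    show "skein_eq ?u [] (Poly_Mapping.single (sigma_inv 2 # T_x) h)
        (Poly_Mapping.single T_zero (- apow (-2) * h)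
          + Poly_Mapping.single T_infinity (- (apow (-1) * mpow 1) * h))" if "h \<noteq> 0"
    proof -
      have T_x: "tangle ?u' [] T_x" using that compat(3) by auto
      then have pq: "p = r" "q \<noteq> r" by (auto simp: tangle_T_x)
      then have "tangle ?u [] (Crossing 2 False # Crossing 2 False # T_zero)"
        by (auto simp: tangle_def T_zero_def)
      from skein_eq_double_crossing[OF this, of h]
      have *: "skein_eq ?u [] (Poly_Mapping.single (sigma_inv 2 # sigma_inv 2 # T_zero) h)
          (Poly_Mapping.single T_zero (- apow (-2) * h)
            + Poly_Mapping.single [Cup 2, Cap 2 r, Cup 1, Cup 0] (- (apow (-1) * mpow 1) * h))"
        by (simp add: sigma_inv_def T_zero_def)
      have iso: "isotopic ?u [] (sigma_inv 2 # T_x) (sigma_inv 2 # sigma_inv 2 # T_zero)"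
        using isotopic_append[of ?u "[sigma_inv 2]" ?u'] isotopic_sym[OF isotopic_T_x[OF T_x]] step
        by simp
      have "local_move [Cap 2 r, Cup 1] []"
        using local_move.zigzag_left[of 1 r] by (simp add: numeral_2_eq_2)
      then have "isotopic ?u [] ([Cup 2] @ [Cap 2 r, Cup 1] @ [Cup 0]) ([Cup 2] @ [] @ [Cup 0])"
        by (rule isotopic_local_move) (use pq in \<open>auto simp: tangle_def\<close>)
      then have iso': "isotopic ?u [] [Cup 2, Cap 2 r, Cup 1, Cup 0] T_infinity"
        by (simp add: T_infinity_def q4_def)
      from skein_eq_isotopic[OF iso] * skein_eq_add[OF skein_eq_refl skein_eq_isotopic[OF iso']]
      show ?thesis by (rule skein_eq_trans[OF skein_eq_trans])
    qed
  qed simp_all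
  then show ?thesis
    using compat unfolding tangle_HOMFLY_def
    by (auto simp: tangle_T_zero tangle_T_infinity tangle_T_x single_add single_diff single_uminus
        algebra_simps)
qed

section \<open>Coefficient vectors and matrix products along the word\<close>

abbreviation tangle_HOMFLY_vec :: "bool list \<Rightarrow> piece list \<Rightarrow> laurent vec \<Rightarrow> bool" where
  "tangle_HOMFLY_vec u D c \<equiv> tangle_HOMFLY u D (c $ 0) (c $ 1) (c $ 2)"

abbreviation letter :: "nat \<Rightarrow> piece" where
  "letter i \<equiv> if odd i then sigma 1 else sigma_inv 2"

abbreviation letter_mat :: "nat \<Rightarrow> nat \<Rightarrow> laurent mat" where
  "letter_mat i k \<equiv> if odd i then A_mat k else B_inv_mat k"

abbreviation strand_type :: "bool list \<Rightarrow> nat \<Rightarrow> nat" where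
  "strand_type u j \<equiv> if u ! j = u ! (j + 1) then 1 else 2"

lemma letter_mat_carrier: "letter_mat i k \<in> carrier_mat 3 3"
  unfolding A_mat_def B_inv_mat_def by (auto intro!: carrier_matI simp: mat_of_rows_list_def)

lemma sum_upt_3: "sum F {0..<3 :: nat} = F 0 + F 1 + F 2"
  by (simp add: numeral_3_eq_3 numeral_2_eq_2)

lemma mult_mat_vec_3:
  fixes c :: "'r :: comm_ring_1 vec"
  assumes "c \<in> carrier_vec 3" "i < 3"
  shows "(mat_of_rows_list 3 [[x\<^sub>0, x\<^sub>1, x\<^sub>2], [y\<^sub>0, y\<^sub>1, y\<^sub>2], [z\<^sub>0, z\<^sub>1, z\<^sub>2]] *\<^sub>v c) $ i =
    [x\<^sub>0, y\<^sub>0, z\<^sub>0] ! i * c $ 0 + [x\<^sub>1, y\<^sub>1, z\<^sub>1] ! i * c $ 1 + [x\<^sub>2, y\<^sub>2, z\<^sub>2] ! i * c $ 2"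
proof -
  have "i = 0 \<or> i = 1 \<or> i = 2" using assms(2) by linarith
  then show ?thesis
    using carrier_vecD[OF assms(1)]
    by (elim disjE) (simp_all add: mat_of_rows_list_def scalar_prod_def sum_upt_3)
qed

lemma length_4_cases:
  assumes "length u = 4"
  obtains p q r s where "u = [p, q, r, s]"
  using assms by (auto simp: eval_nat_numeral length_Suc_conv)

text \<open>Interchanging two directions does not affect whether they agree, so a whole block has a
  single type.\<close>

lemma step_letter:
  assumes "length u = 4"
  shows "\<exists>u'. step u (letter i) = Some u' \<and> length u' = 4 \<and>
    strand_type u' (if odd i then 1 else 2) = strand_type u (if odd i then 1 else 2)"
proof -
  from assms obtain p q r s where "u = [p, q, r, s]" by (rule length_4_cases)
  then show ?thesis by (auto simp: sigma_def sigma_inv_def)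
qed

text \<open>The four matrices record the four preceding expansions, with coordinates in the order
  \<open>T_zero\<close>, \<open>T_infinity\<close>, \<open>T_x\<close>.\<close>

lemma tangle_HOMFLY_letter:
  assumes u: "length u = 4" and step: "step u (letter i) = Some u'"
    and D: "tangle_HOMFLY_vec u' D c" and c: "c \<in> carrier_vec 3"
  shows "tangle_HOMFLY_vec u (letter i # D)
    (letter_mat i (strand_type u (if odd i then 1 else 2)) *\<^sub>v c)"
proof -
  from u obtain p q r s where u: "u = [p, q, r, s]" by (rule length_4_cases)
  show ?thesis
  proof (cases "odd i")
    case True
    then have u': "u' = [p, r, q, s]" using step by (simp add: u sigma_def)
    show ?thesis
    proof (cases "q = r")
      case True
      have "tangle_HOMFLY [p, q, q, s] D (c $ 0) (c $ 1) (c $ 2)"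
        using D u' True by simp
      from tangle_HOMFLY_sigma_parallel[OF this] show ?thesis
        using \<open>odd i\<close> True c by (simp add: u A_mat_def mult_mat_vec_3)
    next
      case False
      then have r: "r = (\<not> q)" by auto
      have "tangle_HOMFLY [p, \<not> q, q, s] D (c $ 0) (c $ 1) (c $ 2)"
        using D u' r by simp
      from tangle_HOMFLY_sigma_antiparallel[OF this] show ?thesis
        using \<open>odd i\<close> r c by (simp add: u A_mat_def mult_mat_vec_3)
    qed
  next
    case False
    then have u': "u' = [p, q, s, r]" using step by (simp add: u sigma_inv_def)
    show ?thesis
    proof (cases "r = s")
      case True
      have "tangle_HOMFLY [p, q, r, r] D (c $ 0) (c $ 1) (c $ 2)"
        using D u' True by simp
      from tangle_HOMFLY_sigma_inv_parallel[OF this] show ?thesis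
        using \<open>\<not> odd i\<close> True c by (simp add: u B_inv_mat_def mult_mat_vec_3)
    next
      case False
      then have s: "s = (\<not> r)" by auto
      have "tangle_HOMFLY [p, q, \<not> r, r] D (c $ 0) (c $ 1) (c $ 2)"
        using D u' s by simp
      from tangle_HOMFLY_sigma_inv_antiparallel[OF this] show ?thesis
        using \<open>\<not> odd i\<close> s c by (simp add: u B_inv_mat_def mult_mat_vec_3)
    qed
  qed
qed

lemma run_replicate_letter:
  assumes "length u = 4"
  shows "\<exists>u'. run u (replicate e (letter i)) = Some u' \<and> length u' = 4"
  using assms
proof (induction e arbitrary: u)
  case (Suc e)
  from step_letter[OF Suc.prems, of i] obtain u' where "step u (letter i) = Some u'" "length u' = 4"
    by blast
  with Suc.IH[of u'] show ?case by simp
qed simp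

text \<open>Matrix powers are defined by multiplication on the right, whereas a crossing added on
  top multiplies from the left.\<close>

lemma pow_mat_Suc_left:
  assumes "A \<in> carrier_mat n n"
  shows "A ^\<^sub>m Suc e = A * A ^\<^sub>m e"
proof (induction e)
  case 0
  then show ?case using assms by simp
next
  case (Suc e)
  have "A ^\<^sub>m Suc (Suc e) = A * A ^\<^sub>m e * A" using Suc by simp
  also have "\<dots> = A * (A ^\<^sub>m e * A)"
    by (rule assoc_mult_mat[OF assms pow_carrier_mat[OF assms] assms])
  finally show ?case by simp
qed

lemma tangle_HOMFLY_block:
  assumes "length u = 4" "run u (replicate e (letter i)) = Some u'"
    and "tangle_HOMFLY_vec u' D c" "c \<in> carrier_vec 3"
  shows "tangle_HOMFLY_vec u (replicate e (letter i) @ D)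
    (letter_mat i (strand_type u (if odd i then 1 else 2)) ^\<^sub>m e *\<^sub>v c)"
  using assms
proof (induction e arbitrary: u)
  case 0
  then show ?case
    using letter_mat_carrier[of i "strand_type u (if odd i then 1 else 2)"] by simp
next
  case (Suc e)
  let ?X = "letter_mat i (strand_type u (if odd i then 1 else 2))"
  have X: "?X \<in> carrier_mat 3 3" by (rule letter_mat_carrier)
  obtain x where x: "step u (letter i) = Some x" "length x = 4"
    "strand_type x (if odd i then 1 else 2) = strand_type u (if odd i then 1 else 2)"
    using step_letter[OF Suc.prems(1), of i] by blast
  have "run x (replicate e (letter i)) = Some u'"
    using Suc.prems(2) x(1) by simp
  from Suc.IH[OF x(2) this Suc.prems(3,4)]
  have "tangle_HOMFLY_vec x (replicate e (letter i) @ D) (?X ^\<^sub>m e *\<^sub>v c)"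
    unfolding x(3) .
  moreover have "?X ^\<^sub>m e *\<^sub>v c \<in> carrier_vec 3"
    by (rule mult_mat_vec_carrier[OF pow_carrier_mat[OF X] Suc.prems(4)])
  ultimately have "tangle_HOMFLY_vec u (letter i # replicate e (letter i) @ D)
      (?X *\<^sub>v (?X ^\<^sub>m e *\<^sub>v c))"
    by (rule tangle_HOMFLY_letter[OF Suc.prems(1) x(1)])
  moreover have "?X *\<^sub>v (?X ^\<^sub>m e *\<^sub>v c) = ?X ^\<^sub>m Suc e *\<^sub>v c"
    unfolding pow_mat_Suc_left[OF X]
    by (rule assoc_mult_mat_vec[OF X pow_carrier_mat[OF X] Suc.prems(4), symmetric])
  ultimately show ?case by (simp only: replicate_Suc append_Cons)
qed

lemma run_blocks:
  assumes "length u = 4"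
  shows "\<exists>u'. run u (concat (map (block \<epsilon>) is)) = Some u' \<and> length u' = 4"
  using assms
proof (induction "is" arbitrary: u)
  case (Cons i "is")
  obtain u' where "run u (block \<epsilon> i) = Some u'" "length u' = 4"
    using run_replicate_letter[OF Cons.prems] unfolding block_def by blast
  with Cons.IH[of u'] show ?case by (simp add: run_append)
qed simp

lemma tangle_HOMFLY_T_infinity:
  "tangle v [] T_infinity \<Longrightarrow> tangle_HOMFLY v T_infinity 0 1 0"
  by (simp add: tangle_HOMFLY_def skein_eq_refl)

text \<open>The product in \<open>M_mat\<close> over an arbitrary index list, so that the factors of
  a suffix of the word can be addressed.\<close>

abbreviation M_factors :: "(nat \<Rightarrow> nat) \<Rightarrow> (nat \<Rightarrow> nat) \<Rightarrow> nat list \<Rightarrow> laurent mat" where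
  "M_factors \<epsilon> k is \<equiv> foldr (*) (map (\<lambda>i. letter_mat i (k i) ^\<^sub>m \<epsilon> i) is) (1\<^sub>m 3)"

lemma M_factors_carrier: "M_factors \<epsilon> k is \<in> carrier_mat 3 3"
proof (induction "is")
  case (Cons i "is")
  have "letter_mat i (k i) ^\<^sub>m \<epsilon> i \<in> carrier_mat 3 3"
    by (rule pow_carrier_mat[OF letter_mat_carrier])
  from mult_carrier_mat[OF this Cons] show ?case by simp
qed simp

lemma tangle_HOMFLY_alternating_word:
  assumes u: "length u = 4" and link: "tangle u [] (q4 (alternating_word \<epsilon> N))"
    and k: "\<forall>i \<in> {1..N}. k i = block_type u \<epsilon> i"
  shows "tangle_HOMFLY_vec u (q4 (alternating_word \<epsilon> N)) (M_mat N \<epsilon> k *\<^sub>v unit_vec 3 1)"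
proof -
  \<comment> \<open>Downward induction from \<open>N + 1\<close> to 1. Block \<open>j\<close> is the
    first one of the remaining suffix, and \<open>x\<close> is the orientation just above it, where
    \<open>block_type\<close> reads the type.\<close>
  have "tangle_HOMFLY_vec x (q4 (concat (map (block \<epsilon>) [j..<N + 1])))
      (M_factors \<epsilon> k [j..<N + 1] *\<^sub>v unit_vec 3 1)"
    if "j \<le> N + 1" "1 \<le> j" "run u (alternating_word \<epsilon> (j - 1)) = Some x" for j x
    using that
  proof (induction j arbitrary: x rule: inc_induct)
    case base
    \<comment> \<open>No blocks remain. Compatibility of \<open>x\<close> with
      \<open>T_infinity\<close> is inherited from the whole tangle, and \<open>unit_vec 3 1\<close>
      is the coefficient vector of \<open>T_infinity\<close>.\<close>
    then have "tangle x [] T_infinity"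
      using link by (simp add: q4_def T_infinity_def tangle_append)
    then show ?case
      by (simp add: T_infinity_def[symmetric] tangle_HOMFLY_T_infinity)
  next
    case (step j)
    let ?rest = "concat (map (block \<epsilon>) [Suc j..<N + 1])"
    let ?c = "M_factors \<epsilon> k [Suc j..<N + 1] *\<^sub>v unit_vec 3 1"
    let ?X = "letter_mat j (k j)"
    have upt: "[j..<N + 1] = j # [Suc j..<N + 1]" using step.hyps(2) by (rule upt_conv_Cons)
    have x: "length x = 4"
      using run_blocks[OF u, of \<epsilon> "[1..<j - 1 + 1]"] step.prems(2) by (simp add: alternating_word_def)
    obtain y where y: "run x (replicate (\<epsilon> j) (letter j)) = Some y"
      using run_replicate_letter[OF x] by blast
    have "alternating_word \<epsilon> (Suc j - 1) = alternating_word \<epsilon> (j - 1) @ block \<epsilon> j"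
      using step.prems(1) by (cases j) (simp_all add: alternating_word_def)
    then have "run u (alternating_word \<epsilon> (Suc j - 1)) = Some y"
      using step.prems(2) y by (simp add: run_append block_def)
    then have rest: "tangle_HOMFLY_vec y (q4 ?rest) ?c"
      by (rule step.IH[rotated]) simp
    have c: "?c \<in> carrier_vec 3"
      by (rule mult_mat_vec_carrier[OF M_factors_carrier unit_vec_carrier])
    have type: "k j = strand_type x (if odd j then 1 else 2)"
      using k step.hyps step.prems by (simp add: block_type_def Let_def)
    have "tangle_HOMFLY_vec x (replicate (\<epsilon> j) (letter j) @ q4 ?rest) (?X ^\<^sub>m \<epsilon> j *\<^sub>v ?c)"
      unfolding type by (rule tangle_HOMFLY_block[OF x y rest c])
    moreover have "replicate (\<epsilon> j) (letter j) @ q4 ?rest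
        = q4 (concat (map (block \<epsilon>) [j..<N + 1]))"
      unfolding upt by (simp add: q4_def block_def)
    moreover have "?X ^\<^sub>m \<epsilon> j *\<^sub>v ?c = M_factors \<epsilon> k [j..<N + 1] *\<^sub>v unit_vec 3 1"
      unfolding upt list.map foldr_Cons comp_apply
      by (rule assoc_mult_mat_vec[OF pow_carrier_mat[OF letter_mat_carrier] M_factors_carrier
            unit_vec_carrier, symmetric])
    ultimately show ?case by (simp only:)
  qed
  \<comment> \<open>For \<open>j = 1\<close> the prefix is empty, so the orientation above the
    suffix is \<open>u\<close> itself.\<close>
  from this[of 1 u] show ?thesis
    by (simp add: alternating_word_def M_mat_def)
qed


section \<open>Closures of the basic tangles\<close>

text \<open>A kink is created at the minimum of the circle and undone at its maximum, which reverses
  the label there.\<close>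

lemma isotopic_circle_flip:
  assumes "run [] X = Some x" "length x = i" "tangle x [] Y"
  shows "isotopic [] [] (X @ Cap i d # Cup i # Y) (X @ Cap i (\<not> d) # Cup i # Y)"
proof -
  have 1: "isotopic [] [] ((X @ [Cap i d]) @ [Crossing i True, Cup i] @ Y) ((X @ [Cap i d]) @ [Cup i] @ Y)"
    by (rule isotopic_local_move[OF local_move.R1_Cup])
      (use assms in \<open>auto simp: tangle_def run_append nth_append\<close>)
  have 2: "isotopic [] [] (X @ [Cap i d, Crossing i True] @ Cup i # Y)
      (X @ [Cap i (\<not> d)] @ Cup i # Y)"
    by (rule isotopic_local_move[OF local_move.R1_Cap])
      (use assms in \<open>auto simp: tangle_def run_append nth_append\<close>)
  show ?thesis
    using isotopic_trans[OF isotopic_sym[OF 1], of "X @ [Cap i (\<not> d)] @ Cup i # Y"] 2 by simp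
qed

lemma isotopic_unknot: "isotopic [] [] [Cap 0 d, Cup 0] unknot"
proof (cases d)
  case True
  then show ?thesis by (auto simp: unknot_def tangle_def intro!: isotopic_refl)
next
  case False
  then show ?thesis
    using isotopic_circle_flip[of "[]" "[]" 0 "[]" d] by (simp add: unknot_def tangle_def)
qed

lemma isotopic_T_zero_closure:
  assumes "d\<^sub>0 = d\<^sub>1"
  shows "isotopic [] [] ([Cap 0 d\<^sub>0, Cap 2 d\<^sub>1] @ T_zero) unknot"
proof -
  have "local_move [Cap 2 d\<^sub>1, Cup 1] []"
    using local_move.zigzag_left[of 1 d\<^sub>1] by (simp add: numeral_2_eq_2)
  then have "isotopic [] [] ([Cap 0 d\<^sub>0] @ [Cap 2 d\<^sub>1, Cup 1] @ [Cup 0]) ([Cap 0 d\<^sub>0] @ [] @ [Cup 0])"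
    by (rule isotopic_local_move) (use assms in \<open>auto simp: tangle_def\<close>)
  then have "isotopic [] [] ([Cap 0 d\<^sub>0, Cap 2 d\<^sub>1] @ T_zero) [Cap 0 d\<^sub>0, Cup 0]"
    by (simp add: T_zero_def)
  then show ?thesis by (rule isotopic_trans[OF _ isotopic_unknot])
qed

text \<open>The crossing slides past the right maximum and becomes a kink at the right minimum; once
  it is removed, a zigzag remains. Both values of \<open>s\<close> are needed to evaluate the
  unlink.\<close>

lemma isotopic_crossed_closure:
  assumes "d\<^sub>0 \<noteq> d\<^sub>1"
  shows "isotopic [] [] [Cap 0 d\<^sub>0, Cap 2 d\<^sub>1, Crossing 1 s, Cup 2, Cup 0] unknot"
proof -
  have "local_move [Cap 2 d\<^sub>1, Crossing 1 s] [Cap 1 d\<^sub>1, Crossing 2 (\<not> s)]"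
    using local_move.slide_Cap[of 1 d\<^sub>1 s] by (simp add: numeral_2_eq_2)
  then have "isotopic [] [] ([Cap 0 d\<^sub>0] @ [Cap 2 d\<^sub>1, Crossing 1 s] @ [Cup 2, Cup 0])
      ([Cap 0 d\<^sub>0] @ [Cap 1 d\<^sub>1, Crossing 2 (\<not> s)] @ [Cup 2, Cup 0])"
    by (rule isotopic_local_move) (use assms in \<open>auto simp: tangle_def\<close>)
  also have "\<dots> = [Cap 0 d\<^sub>0, Cap 1 d\<^sub>1] @ [Crossing 2 (\<not> s), Cup 2] @ [Cup 0]" by simp
  also have "isotopic [] [] \<dots> ([Cap 0 d\<^sub>0, Cap 1 d\<^sub>1] @ [Cup 2] @ [Cup 0])"
    by (rule isotopic_local_move[OF local_move.R1_Cup]) (use assms in \<open>auto simp: tangle_def\<close>)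
  also have "\<dots> = [Cap 0 d\<^sub>0] @ [Cap 1 d\<^sub>1, Cup 2] @ [Cup 0]" by simp
  also have "isotopic [] [] \<dots> ([Cap 0 d\<^sub>0] @ [] @ [Cup 0])"
  proof (rule isotopic_local_move)
    show "local_move [Cap 1 d\<^sub>1, Cup 2] []"
      using local_move.zigzag_right[of 1 d\<^sub>1] by (simp add: numeral_2_eq_2)
  qed (use assms in \<open>auto simp: tangle_def\<close>)
  finally have "isotopic [] [] [Cap 0 d\<^sub>0, Cap 2 d\<^sub>1, Crossing 1 s, Cup 2, Cup 0] [Cap 0 d\<^sub>0, Cup 0]"
    by simp
  then show ?thesis by (rule isotopic_trans[OF _ isotopic_unknot])
qed

text \<open>With suitable orientations the unlink is the smoothing of a crossing between its two
  circles, and both signs of that crossing give the unknot. The skein relation then determines its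
  value, the inverse of \<open>m\<close> being available as \<open>mpow (-1)\<close>.\<close>

lemma HOMFLY_unlink:
  assumes P: "is_HOMFLY P"
  shows "P ([Cap 0 d\<^sub>0, Cap 2 d\<^sub>1] @ T_infinity) = - ((apow 1 + apow (-1)) * mpow (-1))"
proof -
  have iso: "P D = P D'" if "isotopic [] [] D D'" for D D'
    using P that unfolding is_HOMFLY_def by blast
  \<comment> \<open>Opposite labels make the strands in positions 1 and 2 parallel, so their
    oriented smoothing is two vertical strands.\<close>
  have opposite: "P [Cap 0 d\<^sub>0, Cap 2 (\<not> d\<^sub>0), Cup 2, Cup 0] = - ((apow 1 + apow (-1)) * mpow (-1))"
    (is "P ?U = _")
  proof -
    let ?X = "[Cap 0 d\<^sub>0, Cap 2 (\<not> d\<^sub>0)]"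
    have "skein_triple [] [] (?X @ [Crossing 1 True] @ [Cup 2, Cup 0])
        (?X @ [Crossing 1 False] @ [Cup 2, Cup 0]) ?U"
      using skein_tripleI[of "[]" ?X "[d\<^sub>0, \<not> d\<^sub>0, \<not> d\<^sub>0, d\<^sub>0]" 1 "[]" "[Cup 2, Cup 0]"]
      by (simp add: tangle_def)
    then have "apow 1 * P (?X @ [Crossing 1 True] @ [Cup 2, Cup 0])
        + apow (-1) * P (?X @ [Crossing 1 False] @ [Cup 2, Cup 0]) + mpow 1 * P ?U = 0"
      using P unfolding is_HOMFLY_def by blast
    moreover have "P (?X @ [Crossing 1 s] @ [Cup 2, Cup 0]) = 1" for s
      using iso[OF isotopic_crossed_closure[of d\<^sub>0 "\<not> d\<^sub>0" s]] P by (simp add: is_HOMFLY_def)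
    ultimately have "mpow (-1) * (apow 1 + apow (-1) + mpow 1 * P ?U) = 0" by simp
    then have "mpow (-1) * (apow 1 + apow (-1)) + mpow (-1) * mpow 1 * P ?U = 0"
      by (simp add: algebra_simps)
    then have "P ?U + (apow 1 + apow (-1)) * mpow (-1) = 0"
      by (simp add: mpow_mult mpow_0 algebra_simps)
    then show ?thesis by (simp add: eq_neg_iff_add_eq_0)
  qed
  show ?thesis
  proof (cases "d\<^sub>1 = d\<^sub>0")
    case True
    \<comment> \<open>For equal labels, reversing the right circle reduces to the previous
      case.\<close>
    have "isotopic [] [] ([Cap 0 d\<^sub>0] @ Cap 2 d\<^sub>1 # Cup 2 # [Cup 0])
        ([Cap 0 d\<^sub>0] @ Cap 2 (\<not> d\<^sub>1) # Cup 2 # [Cup 0])"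
      by (rule isotopic_circle_flip[where x = "[d\<^sub>0, \<not> d\<^sub>0]"]) (simp_all add: tangle_def)
    from iso[OF this] show ?thesis
      using True opposite by (simp add: T_infinity_def q4_def)
  next
    case False
    then have "d\<^sub>1 = (\<not> d\<^sub>0)" by auto
    then show ?thesis using opposite by (simp add: T_infinity_def q4_def)
  qed
qed

text \<open>The closure of \<open>T_zero\<close> is consistently oriented only for equal labels,
  that of \<open>T_x\<close> only for different ones. In the respective other case the coefficient
  is zero, so the value of \<open>P\<close> there does not matter.\<close>

lemma HOMFLY_closure:
  assumes P: "is_HOMFLY P" and T: "tangle_HOMFLY (induced_orientation d\<^sub>0 d\<^sub>1) (q4 w) f g h"
  shows "P (p4 d\<^sub>0 d\<^sub>1 w) = f - g * (apow 1 + apow (-1)) * mpow (-1) + h"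
proof -
  interpret R: Modules.module "(*) :: laurent \<Rightarrow> laurent \<Rightarrow> laurent"
    by unfold_locales (auto simp: algebra_simps)
  let ?X = "[Cap 0 d\<^sub>0, Cap 2 d\<^sub>1]" and ?u = "induced_orientation d\<^sub>0 d\<^sub>1"
  have iso: "P D = 1" if "isotopic [] [] D unknot" for D
    using P that unfolding is_HOMFLY_def by metis
  have "run [] ?X = Some ?u" by (simp add: induced_orientation_def)
  moreover have "skein_eq ?u [] (Poly_Mapping.single (q4 w) 1)
      (Poly_Mapping.single T_zero f + Poly_Mapping.single T_infinity g + Poly_Mapping.single T_x h)"
    using T by (simp add: tangle_HOMFLY_def)
  ultimately have "linear_extension (*) (\<lambda>D. P (?X @ D)) (Poly_Mapping.single (q4 w) 1) =
      linear_extension (*) (\<lambda>D. P (?X @ D)) (Poly_Mapping.single T_zero f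
        + Poly_Mapping.single T_infinity g + Poly_Mapping.single T_x h)"
    by (rule skein_eq_HOMFLY[OF P])
  then have closure: "P (p4 d\<^sub>0 d\<^sub>1 w)
      = f * P (?X @ T_zero) + g * P (?X @ T_infinity) + h * P (?X @ T_x)"
    by (simp add: R.linear_extension_add R.linear_extension_single p4_def)
  have zero: "f * P (?X @ T_zero) = f"
  proof (cases "f = 0")
    case False
    then have "d\<^sub>0 = d\<^sub>1"
      using T by (auto simp: tangle_HOMFLY_def induced_orientation_def tangle_T_zero)
    then show ?thesis using iso[OF isotopic_T_zero_closure] by simp
  qed simp
  have x: "h * P (?X @ T_x) = h"
  proof (cases "h = 0")
    case False
    then have "d\<^sub>0 \<noteq> d\<^sub>1"
      using T by (auto simp: tangle_HOMFLY_def induced_orientation_def tangle_T_x)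
    then show ?thesis
      using iso[OF isotopic_crossed_closure, of d\<^sub>0 d\<^sub>1 True]
      by (simp add: T_x_def q4_def sigma_def)
  qed simp
  show ?thesis
    unfolding closure zero x HOMFLY_unlink[OF P]
    by (simp only: mult.assoc mult_minus_right add_uminus_conv_diff)
qed

text \<open>Translates the row-vector form with the transpose into the product of \<open>M\<close>
  with a unit vector, the form produced by the induction over blocks.\<close>

lemma second_column:
  fixes M :: "'r :: comm_ring_1 mat"
  assumes M: "M \<in> carrier_mat 3 3"
    and eq: "mat_of_rows_list 3 [[f, g, h]] = mat_of_rows_list 3 [[0, 1, 0]] * transpose_mat M"
  shows "(M *\<^sub>v unit_vec 3 1) $ 0 = f" "(M *\<^sub>v unit_vec 3 1) $ 1 = g"
    "(M *\<^sub>v unit_vec 3 1) $ 2 = h"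
proof -
  have "[f, g, h] ! j = (M *\<^sub>v unit_vec 3 1) $ j" if "j < 3" for j
  proof -
    have "[f, g, h] ! j = mat_of_rows_list 3 [[f, g, h]] $$ (0, j)"
      using that by (simp add: mat_of_rows_list_def)
    also have "\<dots> = (M *\<^sub>v unit_vec 3 1) $ j"
      unfolding eq using that carrier_matD[OF M]
      by (simp add: mat_of_rows_list_def scalar_prod_def sum_upt_3)
    finally show ?thesis .
  qed
  from this[of 0] this[of 1] this[of 2] show
    "(M *\<^sub>v unit_vec 3 1) $ 0 = f" "(M *\<^sub>v unit_vec 3 1) $ 1 = g" "(M *\<^sub>v unit_vec 3 1) $ 2 = h"
    by simp_all
qed

theorem theorem2:
  fixes n :: nat and \<epsilon> k :: "nat \<Rightarrow> nat" and w K :: "piece list" and d\<^sub>0 d\<^sub>1 :: bool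
    and u :: "bool list" and M :: "laurent mat" and f g h :: laurent
  assumes "n \<ge> 1"
    and "\<forall>i \<in> {1..2 * n - 1}. \<epsilon> i \<ge> 1"
    and "w = alternating_word \<epsilon> (2 * n - 1)"
    and "K = p4 d\<^sub>0 d\<^sub>1 w"
    and "two_bridge_knot K"
    and "u = induced_orientation d\<^sub>0 d\<^sub>1"
    and "\<forall>i \<in> {1..2 * n - 1}. k i = block_type u \<epsilon> i"
    and "M = M_mat (2 * n - 1) \<epsilon> k"
    and "mat_of_rows_list 3 [[f, g, h]] = mat_of_rows_list 3 [[0, 1, 0]] * transpose_mat M"
  shows "tangle_HOMFLY u (q4 w) f g h \<and>
    (\<forall>P. is_HOMFLY P \<longrightarrow> P K = f - g * (apow 1 + apow (-1)) * mpow (-1) + h)"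
proof -
  \<comment> \<open>The knot is a consistently oriented closed diagram; taking off its two top arcs
    leaves \<open>q4 w\<close> as a tangle with endpoint orientation \<open>u\<close>.\<close>
  have "link K"
    using assms(5) by (simp add: two_bridge_knot_def knot_def)
  moreover have "run [] [Cap 0 d\<^sub>0, Cap 2 d\<^sub>1] = Some u"
    by (simp add: assms(6) induced_orientation_def)
  ultimately have "tangle u [] (q4 w)"
    using assms(4) tangle_append[of "[]" "[Cap 0 d\<^sub>0, Cap 2 d\<^sub>1]" u] by (simp add: p4_def)
  moreover have "length u = 4" by (simp add: assms(6) induced_orientation_def)
  ultimately have "tangle_HOMFLY_vec u (q4 w) (M *\<^sub>v unit_vec 3 1)"
    using tangle_HOMFLY_alternating_word assms(3,7,8) by simp
  moreover have "M \<in> carrier_mat 3 3"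
    unfolding assms(8) M_mat_def by (rule M_factors_carrier)
  ultimately have "tangle_HOMFLY u (q4 w) f g h"
    using second_column[OF _ assms(9)] by simp
  then show ?thesis
    using HOMFLY_closure assms(4,6) by blast
qed

end
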